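(* Algorithm VT (the Valuation Tracking Procedure described in the context) is $c^*(\mathcal{P})$-competitive: for every $T\ge1$ and every sequence $(V_1,\ldots,V_T)\in\{r^{(0)},\ldots,r^{(m)}\}^T$, $\mathbb{E}[\mathsf{ALG}(V_1,\ldots,V_T)]\ge c^*(\mathcal{P})\cdot\mathsf{OPT}(V_1,\ldots,V_T)$.
   Context: Setting (single-item dynamic pricing, public pricing, deterministic valuations). Fix an integer $m\ge1$ and prices $0<r^{(1)}<\cdots<r^{(m)}$; let $\mathcal{P}=\{r^{(1)},\ldots,r^{(m)}\}$, $r^{(0)}=0$ and $r^{(m+1)}=\infty$. A firm has $k\ge1$ units of inventory. Customers $t=1,\ldots,T$ arrive in order ($T$ is unknown to the algorithm); customer $t$ has valuation $V_t\in\{r^{(0)},\ldots,r^{(m)}\}$. An online algorithm chooses a (possibly random) price $P_t\in\{r^{(1)},\ldots,r^{(m+1)}\}$ using only $P_1,V_1,\ldots,P_{t-1},V_{t-1}$; it must set $P_t=\infty$ when no inventory remains. The sale indicator is $X_t=\mathbb{1}(V_t\ge P_t)$ and the revenue is $\mathsf{ALG}(V_1,\ldots,V_T)=\sum_t P_tX_t$. $\mathsf{OPT}(V_1,\ldots,V_T)$ is the sum of the $\min\{k,T\}$ largest values among $V_1,\ldots,V_T$. An algorithm is $c$-competitive if $\mathbb{E}[\mathsf{ALG}]\ge c\cdot\mathsf{OPT}$ for all $T$ and all sequences. Define $q^{(j)}=1-r^{(j-1)}/r^{(j)}$ for $j\in\{1,\ldots,m\}$, $q=\sum_{j=1}^m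 q^{(j)}$, and $c^*(\mathcal{P})=1/q$. Algorithm VT: initialize $\mathtt{level}[i]=0$ and $\mathtt{sold}[i]=\mathtt{false}$ for $i=1,\ldots,k$. For each arriving customer $t$: let $i^*_t$ be an index minimizing $\mathtt{level}[i]$ (ties broken by a fixed deterministic rule), and let $\ell_t\in\{0,\ldots,m\}$ satisfy $\mathtt{level}[i^*_t]=r^{(\ell_t)}$. If $\mathtt{sold}[i^*_t]=\mathtt{false}$, choose the price $r^{(j)}$, $j\in\{\ell_t+1,\ldots,m\}$, with probability $q^{(j)}/\sum_{j'=\ell_t+1}^m q^{(j')}$; otherwise choose price $\infty$. Then observe $V_t$ and $X_t$, set $\mathtt{level}[i^*_t]=\max\{\mathtt{level}[i^*_t],V_t\}$, and if $X_t=1$ set $\mathtt{sold}[i^*_t]=\mathtt{true}$. *)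

theory Defs
  imports "HOL-Probability.Probability"
begin

section \<open>Online pricing algorithms\<close>

text \<open>
  Prices live in \<^typ>\<open>ereal\<close>, the price \<open>\<infinity>\<close> standing for a rejection, and
  \<open>r 0 = 0 < r 1 < \<dots> < r m\<close> are the finite values. A history lists the pairs
  \<open>(P\<^sub>t, V\<^sub>t)\<close> of the past customers in order of arrival. A randomised algorithm is given by the
  conditional distribution of its next price given the history; it does not see \<open>T\<close>.
\<close>

type_synonym history = "(ereal \<times> real) list"
type_synonym algorithm = "history \<Rightarrow> ereal pmf"

definition sale :: "ereal \<Rightarrow> real \<Rightarrow> bool" where
  "sale P V \<longleftrightarrow> ereal V \<ge> P"

definition sales :: "history \<Rightarrow> nat" where
  "sales h = length (filter (\<lambda>(P, V). sale P V) h)"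

text \<open>In \<^typ>\<open>ereal\<close>, \<open>\<infinity> * 0 = 0\<close>, so a rejected customer contributes \<open>0\<close>.\<close>

definition revenue :: "history \<Rightarrow> real" where
  "revenue h = (\<Sum>(P, V)\<leftarrow>h. real_of_ereal (P * of_bool (sale P V)))"

text \<open>The distribution of the history after the customers with valuations \<open>Vs\<close>.\<close>

definition run :: "algorithm \<Rightarrow> real list \<Rightarrow> history pmf" where
  "run A Vs = foldl (\<lambda>D V. bind_pmf D (\<lambda>h. map_pmf (\<lambda>P. h @ [(P, V)]) (A h))) (return_pmf []) Vs"

definition expected_ALG :: "algorithm \<Rightarrow> real list \<Rightarrow> real" where
  "expected_ALG A Vs = measure_pmf.expectation (run A Vs) revenue"

definition OPT :: "nat \<Rightarrow> real list \<Rightarrow> real" where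
  "OPT k Vs = sum_list (take (min k (length Vs)) (rev (sort Vs)))"

definition online_algorithm :: "(nat \<Rightarrow> real) \<Rightarrow> nat \<Rightarrow> nat \<Rightarrow> algorithm \<Rightarrow> bool" where
  "online_algorithm r m k A \<longleftrightarrow>
     (\<forall>Vs h. set Vs \<subseteq> r ` {0..m} \<and> h \<in> set_pmf (run A Vs) \<longrightarrow>
        set_pmf (A h) \<subseteq> (\<lambda>j. ereal (r j)) ` {1..m} \<union> {\<infinity>} \<and>
        (sales h \<ge> k \<longrightarrow> A h = return_pmf \<infinity>))"

definition competitive :: "(nat \<Rightarrow> real) \<Rightarrow> nat \<Rightarrow> nat \<Rightarrow> real \<Rightarrow> algorithm \<Rightarrow> bool" where
  "competitive r m k c A \<longleftrightarrow>
     (\<forall>Vs. length Vs \<ge> 1 \<and> set Vs \<subseteq> r ` {0..m} \<longrightarrow> expected_ALG A Vs \<ge> c * OPT k Vs)"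

definition q :: "(nat \<Rightarrow> real) \<Rightarrow> nat \<Rightarrow> real" where
  "q r j = 1 - r (j - 1) / r j"

definition c_star :: "(nat \<Rightarrow> real) \<Rightarrow> nat \<Rightarrow> real" where
  "c_star r m = 1 / (\<Sum>j=1..m. q r j)"


section \<open>The Valuation Tracking Procedure\<close>

text \<open>
  The tie-breaking rule is a function \<open>pick\<close> from level vectors to minimising indices. It must not
  depend on \<open>sold\<close>: a rule preferring sold units among those of minimal level would lose revenue.
\<close>

definition tie_breaking :: "nat \<Rightarrow> ((nat \<Rightarrow> real) \<Rightarrow> nat) \<Rightarrow> bool" where
  "tie_breaking k pick \<longleftrightarrow> (\<forall>level. is_arg_min level (\<lambda>i. i \<in> {1..k}) (pick level))"

type_synonym vt_state = "(nat \<Rightarrow> real) \<times> (nat \<Rightarrow> bool)"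

definition vt_update :: "((nat \<Rightarrow> real) \<Rightarrow> nat) \<Rightarrow> ereal \<times> real \<Rightarrow> vt_state \<Rightarrow> vt_state" where
  "vt_update pick = (\<lambda>(P, V) (level, sold). let i = pick level in
     (level(i := max (level i) V), if sale P V then sold(i := True) else sold))"

definition vt_state :: "((nat \<Rightarrow> real) \<Rightarrow> nat) \<Rightarrow> history \<Rightarrow> vt_state" where
  "vt_state pick h = fold (vt_update pick) h (\<lambda>_. 0, \<lambda>_. False)"

text \<open>
  For \<open>l = m\<close> the weights below vanish and \<^const>\<open>embed_pmf\<close> is unspecified; an unsold unit never
  reaches level \<open>r m\<close>, see \<open>vt_invariant\<close>.
\<close>

definition vt_price_index :: "(nat \<Rightarrow> real) \<Rightarrow> nat \<Rightarrow> nat \<Rightarrow> nat pmf" where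
  "vt_price_index r m l =
     embed_pmf (\<lambda>j. if j \<in> {l+1..m} then q r j / (\<Sum>j'=l+1..m. q r j') else 0)"

definition VT :: "(nat \<Rightarrow> real) \<Rightarrow> nat \<Rightarrow> ((nat \<Rightarrow> real) \<Rightarrow> nat) \<Rightarrow> algorithm" where
  "VT r m pick h =
     (let (level, sold) = vt_state pick h;
          i = pick level;
          l = (THE l. l \<in> {0..m} \<and> level i = r l)
      in if \<not> sold i then map_pmf (\<lambda>j. ereal (r j)) (vt_price_index r m l)
         else return_pmf \<infinity>)"


section \<open>The procedure is an online algorithm\<close>

lemma run_Nil [simp]: "run A [] = return_pmf []"
  by (simp add: run_def)

lemma run_snoc:
  "run A (Vs @ [V]) = bind_pmf (run A Vs) (\<lambda>h. map_pmf (\<lambda>P. h @ [(P, V)]) (A h))"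
  by (simp add: run_def)

lemma q_pos:
  assumes "r 0 = 0" "strict_mono_on {0..m} r" "1 \<le> j" "j \<le> m"
  shows "q r j > 0"
proof -
  have "r (j - 1) < r j" "r 0 < r j"
    using assms(3,4) by (auto intro!: strict_mono_onD[OF assms(2)])
  with assms(1) show ?thesis by (simp add: q_def field_simps)
qed

lemma pmf_vt_price_index:
  assumes "r 0 = 0" "strict_mono_on {0..m} r" "l < m"
  shows "pmf (vt_price_index r m l) j =
           (if j \<in> {l+1..m} then q r j / (\<Sum>j'=l+1..m. q r j') else 0)"
proof -
  let ?S = "\<Sum>j'=l+1..m. q r j'"
  let ?f = "\<lambda>j. if j \<in> {l+1..m} then q r j / ?S else 0"
  have S: "?S > 0"
    using assms by (intro sum_pos q_pos) auto
  have nonneg: "?f j \<ge> 0" for j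
    using S q_pos[OF assms(1,2), of j] by (auto intro!: divide_nonneg_pos less_imp_le)
  have "(\<integral>\<^sup>+ j. ennreal (?f j) \<partial>count_space UNIV) = (\<Sum>j\<in>{l+1..m}. ennreal (?f j))"
    by (rule nn_integral_count_space') auto
  also have "\<dots> = ennreal (\<Sum>j\<in>{l+1..m}. ?f j)"
    using nonneg by (intro sum_ennreal)
  also have "(\<Sum>j\<in>{l+1..m}. ?f j) = (\<Sum>j\<in>{l+1..m}. q r j / ?S)"
    by (intro sum.cong) auto
  also have "\<dots> = 1"
    using S by (simp flip: sum_divide_distrib)
  finally show ?thesis
    unfolding vt_price_index_def using nonneg by (subst pmf_embed_pmf) auto
qed

lemma set_vt_price_index:
  assumes "r 0 = 0" "strict_mono_on {0..m} r" "l < m"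
  shows "set_pmf (vt_price_index r m l) \<subseteq> {l+1..m}"
  using pmf_vt_price_index[OF assms] by (auto simp: set_pmf_iff split: if_splits)

lemma level_index:
  fixes r :: "nat \<Rightarrow> real"
  assumes "strict_mono_on {0..m} r" "l \<in> {0..m}"
  shows "(THE l'. l' \<in> {0..m} \<and> r l = r l') = l"
  using assms inj_onD[OF strict_mono_on_imp_inj_on[OF assms(1)]] by (intro the_equality) auto

lemma sales_snoc: "sales (h @ [(P, V)]) = sales h + of_bool (sale P V)"
  by (simp add: sales_def)

lemma vt_state_snoc:
  "vt_state pick (h @ [x]) = vt_update pick x (vt_state pick h)"
  by (simp add: vt_state_def)

lemma VT_unsold:
  assumes "r 0 = 0" "strict_mono_on {0..m} r" "vt_state pick h = (level, sold)"
    and "\<not> sold (pick level)" "level (pick level) \<in> r ` {0..m}" "level (pick level) < r m"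
  obtains l where "l < m" "level (pick level) = r l"
    "VT r m pick h = map_pmf (\<lambda>j. ereal (r j)) (vt_price_index r m l)"
    "set_pmf (VT r m pick h) \<subseteq> (\<lambda>j. ereal (r j)) ` {l+1..m}"
proof -
  obtain l where l: "l \<in> {0..m}" "level (pick level) = r l" using assms(5) by auto
  with assms(6) have "l < m" by (cases "l = m") auto
  moreover have eq: "VT r m pick h = map_pmf (\<lambda>j. ereal (r j)) (vt_price_index r m l)"
    using assms(3,4) l level_index[OF assms(2) l(1)] by (simp add: VT_def)
  moreover have "set_pmf (VT r m pick h) \<subseteq> (\<lambda>j. ereal (r j)) ` {l+1..m}"
    unfolding eq set_map_pmf
    by (intro image_mono set_vt_price_index assms \<open>l < m\<close>)
  ultimately show ?thesis using l that by blast
qed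

lemma VT_sold:
  assumes "vt_state pick h = (level, sold)" "sold (pick level)"
  shows "VT r m pick h = return_pmf \<infinity>"
  using assms by (simp add: VT_def)

lemma vt_invariant:
  assumes "r 0 = 0" "strict_mono_on {0..m} r" "m \<ge> 1" "tie_breaking k pick"
    and "set Vs \<subseteq> r ` {0..m}" "h \<in> set_pmf (run (VT r m pick) Vs)"
    and "vt_state pick h = (level, sold)"
  shows "(\<forall>i. level i \<in> r ` {0..m}) \<and> (\<forall>i. \<not> sold i \<longrightarrow> level i < r m) \<and>
         {i. sold i} \<subseteq> {1..k} \<and> card {i. sold i} = sales h"
  using assms(5-7)
proof (induction Vs arbitrary: h level sold rule: rev_induct)
  case Nil
  have "r 0 < r m" using assms(3) by (intro strict_mono_onD[OF assms(2)]) auto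
  moreover have "0 \<in> r ` {0..m}" using assms(1) by (metis atLeast0AtMost atMost_iff imageI zero_le)
  ultimately show ?case using Nil assms(1) by (auto simp: vt_state_def sales_def)
next
  case (snoc V Vs)
  obtain h' P where h': "h' \<in> set_pmf (run (VT r m pick) Vs)" "P \<in> set_pmf (VT r m pick h')"
    "h = h' @ [(P, V)]"
    using snoc.prems(2) by (auto simp: run_snoc)
  obtain lev s where st: "vt_state pick h' = (lev, s)" by fastforce
  define i where "i = pick lev"
  have IH: "\<forall>i. lev i \<in> r ` {0..m}" "\<forall>i. \<not> s i \<longrightarrow> lev i < r m" "{i. s i} \<subseteq> {1..k}"
    "card {i. s i} = sales h'"
    using snoc.IH[OF _ h'(1) st] snoc.prems(1) by auto
  have V: "V \<in> r ` {0..m}" using snoc.prems(1) by auto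
  have i: "i \<in> {1..k}"
    using assms(4) by (auto simp: tie_breaking_def is_arg_min_def i_def)
  have new: "level = lev(i := max (lev i) V)" "sold = (if sale P V then s(i := True) else s)"
    using snoc.prems(3) st by (auto simp: h'(3) vt_state_snoc vt_update_def i_def Let_def)
  have 1: "\<forall>j. level j \<in> r ` {0..m}"
    using IH(1) V by (auto simp: new(1) max_def)
  show ?case
  proof (cases "s i")
    case True
    then have "P = \<infinity>" using VT_sold[OF st] h'(2) by (simp add: i_def)
    then have "\<not> sale P V" by (simp add: sale_def)
    with 1 IH True show ?thesis by (auto simp: new h'(3) sales_snoc)
  next
    case False
    obtain l where l: "set_pmf (VT r m pick h') \<subseteq> (\<lambda>j. ereal (r j)) ` {l+1..m}"
      by (rule VT_unsold[OF assms(1,2) st]) (use False IH in \<open>auto simp: i_def\<close>)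
    then obtain j where j: "P = ereal (r j)" "j \<in> {l+1..m}" using h'(2) by auto
    show ?thesis
    proof (cases "sale P V")
      case True
      have eq: "{x. x = i \<or> s x} = insert i {x. s x}" by auto
      have "finite {x. s x}" using IH(3) finite_subset by blast
      then have "card {x. x = i \<or> s x} = Suc (sales h')"
        unfolding eq using False IH(4) by simp
      moreover have "{x. sold x} = {x. x = i \<or> s x}" using True by (auto simp: new(2))
      ultimately show ?thesis
        using 1 IH True i by (auto simp: new h'(3) sales_snoc)
    next
      case False': False
      have "r j \<le> r m"
        using j(2) strict_mono_onD[OF assms(2), of j m] by (cases "j = m") auto
      with False' j(1) have "V < r m" by (simp add: sale_def)
      with 1 IH False False' show ?thesis by (auto simp: new h'(3) sales_snoc)
    qed
  qed
qed

lemma online_algorithm_VT: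
  assumes "r 0 = 0" "strict_mono_on {0..m} r" "m \<ge> 1" "tie_breaking k pick"
  shows "online_algorithm r m k (VT r m pick)"
  unfolding online_algorithm_def
proof (intro allI impI, elim conjE)
  fix Vs h
  assume *: "set Vs \<subseteq> r ` {0..m}" "h \<in> set_pmf (run (VT r m pick) Vs)"
  obtain level sold where st: "vt_state pick h = (level, sold)" by fastforce
  note inv = vt_invariant[OF assms * st]
  have i: "pick level \<in> {1..k}"
    using assms(4) by (auto simp: tie_breaking_def is_arg_min_def)
  show "set_pmf (VT r m pick h) \<subseteq> (\<lambda>j. ereal (r j)) ` {1..m} \<union> {\<infinity>} \<and>
        (sales h \<ge> k \<longrightarrow> VT r m pick h = return_pmf \<infinity>)"
  proof (cases "sold (pick level)")
    case True
    then show ?thesis using VT_sold[OF st] by auto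
  next
    case False
    obtain l where l: "set_pmf (VT r m pick h) \<subseteq> (\<lambda>j. ereal (r j)) ` {l+1..m}"
      by (rule VT_unsold[OF assms(1,2) st]) (use False inv in auto)
    have "{x. sold x} \<subset> {1..k}" using inv False i by auto
    then have "sales h < k" using inv psubset_card_mono[of "{1..k}" "{x. sold x}"] by auto
    moreover have "(\<lambda>j. ereal (r j)) ` {l+1..m} \<subseteq> (\<lambda>j. ereal (r j)) ` {1..m}" by auto
    ultimately show ?thesis using l by auto
  qed
qed

end

(* The level of every unit is a deterministic function of the valuations; only the sold flags are
   random. Writing S l for the sum of the q j with j > l, a unit at level r l is unsold with
   probability S l / S 0: raising its level from r l to r w keeps an unsold unit unsold with
   probability S w / S l. Since r j * q j = r j - r (j - 1) telescopes, such a step earns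
   (r w - r l) / S l in expectation from an unsold unit, hence (r w - r l) / S 0 overall, so the
   expected revenue is the sum of the final levels divided by S 0 = q.

   The sum of the final levels dominates OPT by a threshold argument: for every x at or above the
   minimal level, the levels and the valuations have the same total excess over x. *)

theory Submission
  imports Defs
begin

section \<open>Histories with finite support and the step expectation\<close>

lemma map_snd_run: "h \<in> set_pmf (run A Vs) \<Longrightarrow> map snd h = Vs"
  by (induction Vs arbitrary: h rule: rev_induct) (auto simp: run_snoc)

text \<open>Only finitely many prices are ever offered, so every real function of the history is
  integrable and expectations reduce to finite sums.\<close>

lemma finite_set_run:
  assumes "online_algorithm r m k A" "set Vs \<subseteq> r ` {0..m}"
  shows "finite (set_pmf (run A Vs))"
  using assms(2)
proof (induction Vs rule: rev_induct)
  case (snoc V Vs)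
  have "finite (set_pmf (A h))" if "h \<in> set_pmf (run A Vs)" for h
    using assms(1) snoc.prems that unfolding online_algorithm_def
    by (intro finite_subset[of "set_pmf (A h)" "(\<lambda>j. ereal (r j)) ` {1..m} \<union> {\<infinity>}"]) auto
  with snoc show ?case by (simp add: run_snoc)
qed simp

lemma expectation_run_snoc:
  fixes f :: "history \<Rightarrow> real"
  assumes "online_algorithm r m k A" "set (Vs @ [V]) \<subseteq> r ` {0..m}"
  shows "measure_pmf.expectation (run A (Vs @ [V])) f =
         measure_pmf.expectation (run A Vs)
           (\<lambda>h. measure_pmf.expectation (A h) (\<lambda>P. f (h @ [(P, V)])))"
proof -
  have fin: "finite (set_pmf (run A Vs))"
    using finite_set_run[OF assms(1)] assms(2) by auto
  have "finite (set_pmf (A h))" if "h \<in> set_pmf (run A Vs)" for h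
    using assms that unfolding online_algorithm_def
    by (intro finite_subset[of "set_pmf (A h)" "(\<lambda>j. ereal (r j)) ` {1..m} \<union> {\<infinity>}"]) auto
  then show ?thesis
    unfolding run_snoc using fin
    by (subst pmf_expectation_bind[of "set_pmf (run A Vs)"])
       (auto simp: integral_measure_pmf[of "set_pmf (run A Vs)"])
qed

lemma revenue_snoc:
  "revenue (h @ [(P, V)]) = revenue h + (if sale P V then real_of_ereal P else 0)"
  by (simp add: revenue_def)

section \<open>Deterministic levels and the bound on \<open>OPT\<close>\<close>

definition levels :: "((nat \<Rightarrow> real) \<Rightarrow> nat) \<Rightarrow> real list \<Rightarrow> nat \<Rightarrow> real" where
  "levels pick Vs = fold (\<lambda>V L. L(pick L := max (L (pick L)) V)) Vs (\<lambda>_. 0)"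

lemma levels_Nil [simp]: "levels pick [] = (\<lambda>_. 0)"
  by (simp add: levels_def)

lemma levels_snoc:
  "levels pick (Vs @ [V]) =
     (let L = levels pick Vs in L(pick L := max (L (pick L)) V))"
  by (simp add: levels_def Let_def)

text \<open>Neither \<open>pick\<close> nor the update of a level consults prices or
  \<open>sold\<close> flags, so the level component of the state carries no randomness.\<close>

lemma fst_vt_state: "fst (vt_state pick h) = levels pick (map snd h)"
proof (induction h rule: rev_induct)
  case (snoc x h)
  then show ?case
    by (cases x; cases "vt_state pick h")
       (simp add: vt_state_snoc vt_update_def levels_snoc Let_def)
qed (simp add: vt_state_def)

lemma vt_state_run:
  "h \<in> set_pmf (run A Vs) \<Longrightarrow> vt_state pick h = (levels pick Vs, snd (vt_state pick h))"
  by (metis fst_vt_state map_snd_run prod.collapse)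

text \<open>Each entry kept satisfies \<open>v \<le> x + max 0 (v - x)\<close>, at most
  \<open>k\<close> entries are kept, and the excess of the dropped ones is nonnegative. Keeping
  \<open>n\<close> apart from \<open>k\<close> covers the case of fewer than \<open>k\<close>
  customers.\<close>

lemma sum_list_take_le_threshold:
  fixes xs :: "real list"
  assumes "0 \<le> x" "n \<le> k"
  shows "sum_list (take n xs) \<le> real k * x + (\<Sum>v\<leftarrow>xs. max 0 (v - x))"
  using assms(2)
proof (induction xs arbitrary: n k)
  case Nil
  then show ?case using assms(1) by simp
next
  case (Cons v xs)
  show ?case
  proof (cases n)
    case 0
    have "0 \<le> (\<Sum>v\<leftarrow>v # xs. max 0 (v - x))" by (intro sum_list_nonneg) auto
    with 0 assms(1) show ?thesis by simp
  next
    case (Suc n')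
    then obtain k' where k': "k = Suc k'" "n' \<le> k'" using Cons.prems by (cases k) auto
    from Cons.IH[OF k'(2)] show ?thesis by (simp add: Suc k'(1) algebra_simps max_def)
  qed
qed

text \<open>The total excess does not depend on the order of the entries; undoing the sort makes it
  comparable with an induction along the arrivals.\<close>

lemma OPT_le_threshold:
  assumes "0 \<le> x"
  shows "OPT k Vs \<le> real k * x + (\<Sum>v\<leftarrow>Vs. max 0 (v - x))"
proof -
  have "(\<Sum>v\<leftarrow>rev (sort Vs). max 0 (v - x)) = (\<Sum>v\<leftarrow>Vs. max 0 (v - x))"
    by (simp only: sum_mset_sum_list[symmetric] mset_map mset_rev mset_sort)
  then show ?thesis
    using sum_list_take_le_threshold[OF assms, of "min k (length Vs)" k "rev (sort Vs)"]
    by (simp add: OPT_def)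
qed

lemma tie_breaking_pick:
  assumes "tie_breaking k pick"
  shows "pick L \<in> {1..k}" and "j \<in> {1..k} \<Longrightarrow> L (pick L) \<le> L j"
  using assms unfolding tie_breaking_def is_arg_min_linorder by auto

lemma sum_fun_upd:
  fixes f :: "'b \<Rightarrow> 'c::ab_group_add"
  assumes "finite I" "i \<in> I"
  shows "(\<Sum>j\<in>I. f ((L(i := y)) j)) = (\<Sum>j\<in>I. f (L j)) + (f y - f (L i))"
proof -
  have "(\<Sum>j\<in>I - {i}. f ((L(i := y)) j)) = (\<Sum>j\<in>I - {i}. f (L j))"
    by (intro sum.cong) auto
  then show ?thesis using assms by (simp add: sum.remove[of I i])
qed

text \<open>A customer only touches a unit of minimal level. If that level is at most
  \<open>x\<close>, the unit has no excess before the update and \<open>max 0 (V - x)\<close> after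
  it.\<close>

lemma excess_levels:
  assumes "tie_breaking k pick" "0 \<le> x" "levels pick Vs (pick (levels pick Vs)) \<le> x"
  shows "(\<Sum>i=1..k. max 0 (levels pick Vs i - x)) = (\<Sum>v\<leftarrow>Vs. max 0 (v - x))"
  using assms(3)
proof (induction Vs rule: rev_induct)
  case Nil
  then show ?case using assms(2) by simp
next
  case (snoc V Vs)
  define L where "L = levels pick Vs"
  define i where "i = pick L"
  define L' where "L' = L(i := max (L i) V)"
  have L': "levels pick (Vs @ [V]) = L'"
    by (simp add: levels_snoc L_def i_def L'_def Let_def)
  have i: "i \<in> {1..k}" "pick L' \<in> {1..k}"
    using tie_breaking_pick[OF assms(1)] by (auto simp: i_def)
  \<comment> \<open>The minimal level never decreases, so the bound by \<open>x\<close> on the later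
    minimum passes back to the earlier one, as the induction hypothesis requires.\<close>
  have "L i \<le> L (pick L')"
    using tie_breaking_pick(2)[OF assms(1) i(2)] by (simp add: i_def)
  also have "\<dots> \<le> L' (pick L')" by (simp add: L'_def)
  also have "\<dots> \<le> x" using snoc.prems by (simp add: L')
  finally have le: "L i \<le> x" .
  have "(\<Sum>j=1..k. max 0 (L' j - x)) =
        (\<Sum>j=1..k. max 0 (L j - x)) + (max 0 (max (L i) V - x) - max 0 (L i - x))"
    unfolding L'_def using sum_fun_upd[of "{1..k}" i "\<lambda>y. max 0 (y - x)"] i by simp
  also have "max 0 (max (L i) V - x) - max 0 (L i - x) = max 0 (V - x)"
    using le by (auto simp: max_def)
  finally show ?case
    using snoc.IH le by (simp add: L' L_def i_def)
qed

lemma levels_nonneg: "0 \<le> levels pick Vs i"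
  by (induction Vs arbitrary: i rule: rev_induct) (simp_all add: levels_snoc Let_def le_max_iff_disj)

lemma OPT_le_sum_levels:
  assumes "tie_breaking k pick"
  shows "OPT k Vs \<le> (\<Sum>i=1..k. levels pick Vs i)"
proof -
  define L where "L = levels pick Vs"
  define x where "x = L (pick L)"
  have x: "0 \<le> x" by (simp add: x_def L_def levels_nonneg)
  have "OPT k Vs \<le> real k * x + (\<Sum>v\<leftarrow>Vs. max 0 (v - x))"
    by (rule OPT_le_threshold[OF x])
  also have "(\<Sum>v\<leftarrow>Vs. max 0 (v - x)) = (\<Sum>i=1..k. max 0 (L i - x))"
    using excess_levels[OF assms x, of Vs] by (simp add: x_def L_def)
  \<comment> \<open>Since \<open>x\<close> is the minimal final level, the truncation at 0 has no
    effect, and the \<open>k\<close> copies of \<open>x\<close> then cancel.\<close>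
  also have "\<dots> = (\<Sum>i=1..k. L i - x)"
    using tie_breaking_pick(2)[OF assms, of _ L]
    by (intro sum.cong refl) (auto simp: x_def max_def)
  also have "real k * x + \<dots> = (\<Sum>i=1..k. L i)"
    by (simp add: sum_subtractf)
  finally show ?thesis by (simp add: L_def)
qed

section \<open>Price weights and the expectation over the next price\<close>

definition q_above :: "(nat \<Rightarrow> real) \<Rightarrow> nat \<Rightarrow> nat \<Rightarrow> real" where
  "q_above r m l = (\<Sum>j=l+1..m. q r j)"

locale vt =
  fixes r :: "nat \<Rightarrow> real" and m k :: nat and pick :: "(nat \<Rightarrow> real) \<Rightarrow> nat"
  assumes m: "m \<ge> 1" and r0: "r 0 = 0" and mono: "strict_mono_on {0..m} r"
    and tie: "tie_breaking k pick"
begin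

lemma r_le_iff: "i \<le> m \<Longrightarrow> j \<le> m \<Longrightarrow> r i \<le> r j \<longleftrightarrow> i \<le> j"
  using strict_mono_on_leD[OF mono, of i j] strict_mono_onD[OF mono, of j i]
  by (cases "i \<le> j") auto

lemma max_r: "i \<le> m \<Longrightarrow> j \<le> m \<Longrightarrow> max (r i) (r j) = r (max i j)"
  by (auto simp: max_def r_le_iff)

lemma q_above_pos: "l < m \<Longrightarrow> 0 < q_above r m l"
  unfolding q_above_def by (intro sum_pos q_pos[OF r0 mono]) auto

lemma sum_r_q: "l \<le> w \<Longrightarrow> w \<le> m \<Longrightarrow> (\<Sum>j=l+1..w. q r j * r j) = r w - r l"
proof -
  assume lw: "l \<le> w" "w \<le> m"
  have "(\<Sum>j=l+1..w. q r j * r j) = (\<Sum>j\<in>{Suc l..w}. r j - r (j - 1))"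
  proof (intro sum.cong)
    fix j assume "j \<in> {Suc l..w}"
    then have "r j \<noteq> 0" using strict_mono_onD[OF mono, of 0 j] lw r0 by force
    then show "q r j * r j = r j - r (j - 1)" by (simp add: q_def field_simps)
  qed auto
  also have "\<dots> = r w - r l" by (rule sum_telescope''[OF lw(1)])
  finally show ?thesis .
qed

lemma levels_in_prices:
  assumes "set Vs \<subseteq> r ` {0..m}"
  shows "levels pick Vs i \<in> r ` {0..m}"
  using assms
proof (induction Vs arbitrary: i rule: rev_induct)
  case Nil
  then show ?case using r0 by (auto intro!: image_eqI[of _ _ 0])
next
  case (snoc V Vs)
  then show ?case by (auto simp: levels_snoc Let_def max_def)
qed

lemma online: "online_algorithm r m k (VT r m pick)"
  by (rule online_algorithm_VT[OF r0 mono m tie])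

text \<open>\<open>q_above r m l\<close> is the normalising constant of the price distribution at
  level \<open>r l\<close>; with \<open>l < m\<close> it is positive.\<close>

lemma expectation_VT:
  fixes g :: "ereal \<Rightarrow> real"
  assumes "vt_state pick h = (L, sold)" "\<not> sold (pick L)" "L (pick L) = r l" "l < m"
  shows "measure_pmf.expectation (VT r m pick h) g =
         (\<Sum>j=l+1..m. q r j * g (ereal (r j))) / q_above r m l"
proof -
  have "VT r m pick h = map_pmf (\<lambda>j. ereal (r j)) (vt_price_index r m l)"
    using assms level_index[OF mono, of l] by (simp add: VT_def)
  then have "measure_pmf.expectation (VT r m pick h) g =
      (\<Sum>j\<in>{l+1..m}. pmf (vt_price_index r m l) j * g (ereal (r j)))"
    using set_vt_price_index[OF r0 mono assms(4)]
    by (simp add: integral_measure_pmf[of "{l+1..m}"] subset_iff)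
  also have "\<dots> = (\<Sum>j\<in>{l+1..m}. q r j * g (ereal (r j)) / q_above r m l)"
    by (intro sum.cong) (auto simp: pmf_vt_price_index[OF r0 mono assms(4)] q_above_def)
  finally show ?thesis by (simp add: sum_divide_distrib)
qed

section \<open>One customer facing an unsold unit\<close>

context
  fixes h L sold l v w
  assumes st: "vt_state pick h = (L, sold)" and unsold: "\<not> sold (pick L)"
    and l: "L (pick L) = r l" "l < m" and v: "v \<le> m"
  defines "w \<equiv> max l v"
begin

lemma expectation_revenue_step:
  "measure_pmf.expectation (VT r m pick h) (\<lambda>P. revenue (h @ [(P, r v)])) =
   revenue h + (r w - r l) / q_above r m l"
proof -
  \<comment> \<open>A sale at price \<open>r j\<close> means \<open>j \<le> v\<close>; as
    \<open>j > l\<close>, this is the same as \<open>j \<le> w\<close>. If \<open>v \<le> l\<close>,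
    then \<open>w = l\<close> and no offered price sells.\<close>
  have "(\<Sum>j=l+1..m. q r j * revenue (h @ [(ereal (r j), r v)])) =
        (\<Sum>j=l+1..m. q r j * revenue h + (if j \<le> w then q r j * r j else 0))"
    using v by (intro sum.cong) (auto simp: revenue_snoc sale_def r_le_iff w_def algebra_simps)
  also have "\<dots> = q_above r m l * revenue h + (\<Sum>j=l+1..w. q r j * r j)"
    using v l by (simp add: sum.distrib q_above_def sum_distrib_right w_def
        flip: sum.inter_filter) (intro sum.cong; auto)
  also have "(\<Sum>j=l+1..w. q r j * r j) = r w - r l"
    using l v by (intro sum_r_q) (auto simp: w_def)
  finally show ?thesis
    using q_above_pos[OF l(2)] by (simp add: expectation_VT[OF st unsold l] field_simps)
qed

lemma expectation_unsold_step:
  "measure_pmf.expectation (VT r m pick h) (\<lambda>P. of_bool (\<not> sale P (r v))) =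
   q_above r m w / q_above r m l"
proof -
  have "(\<Sum>j=l+1..m. q r j * of_bool (\<not> sale (ereal (r j)) (r v))) =
        (\<Sum>j=l+1..m. if j > w then q r j else 0)"
    using v by (intro sum.cong) (auto simp: sale_def r_le_iff w_def)
  also have "\<dots> = q_above r m w"
    unfolding q_above_def
    by (simp add: w_def flip: sum.inter_filter) (intro sum.cong; auto)
  finally show ?thesis by (simp add: expectation_VT[OF st unsold l])
qed

end

section \<open>Probability of being unsold and expected revenue\<close>

lemma unsold_below_top:
  assumes "set Vs \<subseteq> r ` {0..m}" "h \<in> set_pmf (run (VT r m pick) Vs)"
    and "\<not> snd (vt_state pick h) i" "levels pick Vs i = r l" "l \<le> m"
  shows "l < m"
  using vt_invariant[OF r0 mono m tie assms(1,2) vt_state_run[OF assms(2)]] assms(3-5)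
  by (metis le_neq_implies_less less_irrefl)

text \<open>A sold unit stays sold, and an unsold unit survives each step with probability the ratio
  of its new to its old \<open>q_above\<close>; these ratios telescope. At the top level the value
  is 0.\<close>

lemma prob_unsold:
  assumes "set Vs \<subseteq> r ` {0..m}" "levels pick Vs i = r l" "l \<le> m"
  shows "measure_pmf.expectation (run (VT r m pick) Vs)
           (\<lambda>h. of_bool (\<not> snd (vt_state pick h) i)) = q_above r m l / q_above r m 0"
  using assms
proof (induction Vs arbitrary: i l rule: rev_induct)
  case Nil
  then have "l = 0" using r_le_iff[of l 0] r0 by auto
  then show ?case using q_above_pos[of 0] m by (simp add: vt_state_def)
next
  case (snoc V Vs)
  let ?A = "VT r m pick"
  define L where "L = levels pick Vs"
  have Vs: "set Vs \<subseteq> r ` {0..m}" using snoc.prems(1) by auto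
  obtain v where v: "V = r v" "v \<le> m" using snoc.prems(1) by auto
  obtain l' where l': "L i = r l'" "l' \<le> m"
    using levels_in_prices[OF Vs, of i] by (auto simp: L_def)
  note IH = snoc.IH[OF Vs, of i l', folded L_def, OF l']
  have new: "r l = (if i = pick L then r (max l' v) else r l')"
    using snoc.prems(2) l' v by (simp add: levels_snoc flip: L_def) (auto simp: max_r)
  \<comment> \<open>Injectivity of \<open>r\<close> on the price indices turns the equation between
    levels into one between indices.\<close>
  then have ll: "l = (if i = pick L then max l' v else l')"
    using snoc.prems(3) l' v r_le_iff
    by (auto intro!: inj_onD[OF strict_mono_on_imp_inj_on[OF mono]] split: if_splits)
  have "measure_pmf.expectation (?A h) (\<lambda>P. of_bool (\<not> snd (vt_state pick (h @ [(P, V)])) i)) =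
        of_bool (\<not> snd (vt_state pick h) i) * (q_above r m l / q_above r m l')"
    if h: "h \<in> set_pmf (run ?A Vs)" for h
  proof -
    define sold where "sold = snd (vt_state pick h)"
    have st: "vt_state pick h = (L, sold)"
      using vt_state_run[OF h] by (simp add: L_def sold_def)
    have upd: "snd (vt_state pick (h @ [(P, V)])) i \<longleftrightarrow> sold i \<or> i = pick L \<and> sale P V" for P
      by (auto simp: vt_state_snoc st vt_update_def Let_def)
    show ?thesis
    proof (cases "sold i")
      case False
      \<comment> \<open>An unsold unit lies strictly below the top level, so the price weights it
        uses have positive sum.\<close>
      then have lm: "l' < m"
        using unsold_below_top[OF Vs h] l' by (simp add: sold_def L_def)
      show ?thesis
      proof (cases "i = pick L")
        case True
        then show ?thesis
          using False expectation_unsold_step[OF st, of l' v] l' lm v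
          unfolding upd ll by (simp flip: sold_def)
      next
        case False': False
        then show ?thesis
          using False q_above_pos[OF lm] by (simp add: upd ll flip: sold_def)
      qed
    qed (simp add: upd flip: sold_def)
  qed
  then have "measure_pmf.expectation (run ?A (Vs @ [V]))
        (\<lambda>h. of_bool (\<not> snd (vt_state pick h) i)) =
      measure_pmf.expectation (run ?A Vs)
        (\<lambda>h. of_bool (\<not> snd (vt_state pick h) i) * (q_above r m l / q_above r m l'))"
    unfolding expectation_run_snoc[OF online snoc.prems(1)]
    by (intro integral_cong_AE) (auto simp: AE_measure_pmf_iff)
  also have "\<dots> = q_above r m l' / q_above r m 0 * (q_above r m l / q_above r m l')"
    using IH by simp
  also have "\<dots> = q_above r m l / q_above r m 0"
  \<comment> \<open>At the top level \<open>q_above r m l'\<close> is 0 and cannot be cancelled;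
    then \<open>l = m\<close> too, and both sides vanish.\<close>
  proof (cases "l' = m")
    case True
    then have "l = m" using ll v by (auto simp: max_def)
    with True show ?thesis by simp
  next
    case False
    then show ?thesis using q_above_pos[of l'] l' by simp
  qed
  finally show ?case .
qed

lemma expected_revenue:
  assumes "set Vs \<subseteq> r ` {0..m}"
  shows "expected_ALG (VT r m pick) Vs = (\<Sum>i=1..k. levels pick Vs i) / q_above r m 0"
  using assms
proof (induction Vs rule: rev_induct)
  case Nil
  then show ?case by (simp add: expected_ALG_def revenue_def)
next
  case (snoc V Vs)
  let ?A = "VT r m pick"
  define L where "L = levels pick Vs"
  define i where "i = pick L"
  have Vs: "set Vs \<subseteq> r ` {0..m}" using snoc.prems(1) by auto
  obtain v where v: "V = r v" "v \<le> m" using snoc.prems(1) by auto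
  obtain l where l: "L i = r l" "l \<le> m"
    using levels_in_prices[OF Vs, of i] by (auto simp: L_def)
  define w where "w = max l v"
  \<comment> \<open>The expected gain from this customer given that unit \<open>i\<close> is unsold.
    It depends only on the valuations, so it factors out of the expectation over histories.\<close>
  define c where "c = (r w - r l) / q_above r m l"
  have step: "measure_pmf.expectation (?A h) (\<lambda>P. revenue (h @ [(P, V)])) =
        revenue h + of_bool (\<not> snd (vt_state pick h) i) * c"
    if h: "h \<in> set_pmf (run ?A Vs)" for h
  proof -
    define sold where "sold = snd (vt_state pick h)"
    have st: "vt_state pick h = (L, sold)"
      using vt_state_run[OF h] by (simp add: L_def sold_def)
    show ?thesis
    proof (cases "sold i")
      case True
      then show ?thesis
        using VT_sold[OF st] by (simp add: i_def revenue_snoc flip: sold_def)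
    next
      case False
      then have "l < m"
        using unsold_below_top[OF Vs h] l by (simp add: sold_def L_def)
      then show ?thesis
        using False expectation_revenue_step[OF st, of l v] l v
        by (simp add: i_def c_def w_def flip: sold_def)
    qed
  qed
  have int: "integrable (measure_pmf (run ?A Vs)) f" for f :: "history \<Rightarrow> real"
    by (intro integrable_measure_pmf_finite finite_set_run[OF online Vs])
  have "expected_ALG ?A (Vs @ [V]) = measure_pmf.expectation (run ?A Vs)
      (\<lambda>h. revenue h + of_bool (\<not> snd (vt_state pick h) i) * c)"
    unfolding expected_ALG_def expectation_run_snoc[OF online snoc.prems(1)]
    by (intro integral_cong_AE) (auto simp: AE_measure_pmf_iff step)
  also have "\<dots> = expected_ALG ?A Vs + q_above r m l / q_above r m 0 * c"
    using prob_unsold[OF Vs, of i l] l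
    by (simp add: Bochner_Integration.integral_add[OF int int] expected_ALG_def L_def)
  also have "q_above r m l / q_above r m 0 * c = (r w - r l) / q_above r m 0"
  \<comment> \<open>For \<open>l = m\<close> also \<open>w = m\<close>: the level does not rise, so
    both sides are 0. Otherwise the factor \<open>q_above r m l\<close> cancels.\<close>
  proof (cases "l = m")
    case True
    then show ?thesis using v by (simp add: w_def c_def)
  next
    case False
    then show ?thesis using q_above_pos[of l] l by (simp add: c_def)
  qed
  \<comment> \<open>The numerator \<open>r w - r l\<close> is exactly the rise of the level of unit
    \<open>i\<close>, and the other levels are unchanged.\<close>
  also have "expected_ALG ?A Vs + (r w - r l) / q_above r m 0 =
      ((\<Sum>j=1..k. L j) + (max (L i) V - L i)) / q_above r m 0"
    using snoc.IH[OF Vs] l v by (simp add: L_def[symmetric] w_def max_r add_divide_distrib)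
  also have "(\<Sum>j=1..k. L j) + (max (L i) V - L i) = (\<Sum>j=1..k. (L(i := max (L i) V)) j)"
    using sum_fun_upd[of "{1..k}" i "\<lambda>y. y" L "max (L i) V"] tie_breaking_pick(1)[OF tie, of L]
    by (simp add: i_def)
  also have "L(i := max (L i) V) = levels pick (Vs @ [V])"
    by (simp add: levels_snoc L_def i_def Let_def)
  finally show ?case .
qed

end

theorem theorem1:
  fixes r :: "nat \<Rightarrow> real" and m k :: nat and pick :: "(nat \<Rightarrow> real) \<Rightarrow> nat"
  assumes "m \<ge> 1" and "k \<ge> 1"
    and "r 0 = 0" and "strict_mono_on {0..m} r"
    and "tie_breaking k pick"
  shows "competitive r m k (c_star r m) (VT r m pick)"
proof -
  interpret vt r m k pick using assms by unfold_locales auto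
  have "c_star r m * OPT k Vs \<le> expected_ALG (VT r m pick) Vs"
    if "set Vs \<subseteq> r ` {0..m}" for Vs
    \<comment> \<open>\<open>q_above r m 0\<close> is the reciprocal of \<open>c_star r m\<close>,
      so dividing the bound on \<open>OPT\<close> by it gives the claim.\<close>
    using OPT_le_sum_levels[OF tie, of Vs] q_above_pos[of 0] m
    by (simp add: expected_revenue[OF that] c_star_def q_above_def divide_right_mono)
  then show ?thesis by (simp add: competitive_def)
qed

end
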